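(* For all positive integers $k$ and $c$, $\operatorname{osat}_{\mathcal G}(k;c)\le 48k^2c^{k^2}$.
   Context: Let $\mathcal G$ be the family of finite complete graphs whose edges are each coloured with one of $c$ colours $1,\dots,c$. For $G,G'\in\mathcal G$, $G'$ extends $G$ if $G$ is a proper subgraph of $G'$ with the same edge colours (i.e. $G'$ is obtained by adding new vertices and coloured edges from them to all other vertices). A graph $G\in\mathcal G$ is semisaturated (for $K_k$ in every colour) if every $G'\in\mathcal G$ extending $G$ contains, for some colour $i$, a monochromatic $K_k$ of colour $i$ not contained in $G$. $\operatorname{osat}_{\mathcal G}(k;c)$ is the minimum number of vertices of such a semisaturated graph. *)

theory Defs
  imports "HOL-Library.Ramsey" "HOL-Library.Extended_Nat"
begin

text \<open>A coloured complete graph is a pair of its vertex set and a colouring of two-element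
  vertex sets; the values of the colouring outside the edges of the graph are irrelevant.
  Vertices are natural numbers, which provides a copy of every finite graph and leaves room
  for a copy of every finite extension of it.\<close>

type_synonym cgraph = "nat set \<times> (nat set \<Rightarrow> nat)"

abbreviation verts :: "cgraph \<Rightarrow> nat set" where
  "verts \<equiv> fst"

abbreviation colour :: "cgraph \<Rightarrow> nat set \<Rightarrow> nat" where
  "colour \<equiv> snd"

definition edges :: "cgraph \<Rightarrow> nat set set" where
  "edges G = nsets (verts G) 2"

definition coloured_complete_graphs :: "nat \<Rightarrow> cgraph set" where
  "coloured_complete_graphs c =
     {G. finite (verts G) \<and> verts G \<noteq> {} \<and> colour G \<in> edges G \<rightarrow> {1..c}}"

definition extends :: "cgraph \<Rightarrow> cgraph \<Rightarrow> bool" where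
  "extends G' G \<longleftrightarrow>
     verts G \<subset> verts G' \<and> (\<forall>e \<in> edges G. colour G' e = colour G e)"

definition mono_clique :: "nat \<Rightarrow> nat \<Rightarrow> cgraph \<Rightarrow> nat set \<Rightarrow> bool" where
  "mono_clique k i G K \<longleftrightarrow>
     K \<in> nsets (verts G) k \<and> (\<forall>e \<in> nsets K 2. colour G e = i)"

definition semisaturated :: "nat \<Rightarrow> nat \<Rightarrow> cgraph \<Rightarrow> bool" where
  "semisaturated k c G \<longleftrightarrow>
     G \<in> coloured_complete_graphs c \<and>
     (\<forall>G' \<in> coloured_complete_graphs c. extends G' G \<longrightarrow>
        (\<exists>i \<in> {1..c}. \<exists>K. mono_clique k i G' K \<and> \<not> K \<subseteq> verts G))"

text \<open>The infimum is taken in the extended naturals: it is the minimum if a semisaturated graph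
  exists and infinite otherwise, so a finite upper bound includes existence.\<close>

definition osat :: "nat \<Rightarrow> nat \<Rightarrow> enat" where
  "osat k c = (INF G \<in> {G. semisaturated k c G}. enat (card (verts G)))"

end

theory Submission
  imports Defs Complex_Main
begin

text \<open>Only extensions by a single vertex matter, and such an extension is a map \<open>f\<close> from the
  vertices to the colours. It thus suffices that for every \<open>f\<close> there are a colour \<open>i\<close> and a
  clique of \<open>k - 1\<close> vertices of colour \<open>i\<close> on which \<open>f\<close> is constantly \<open>i\<close>.

  Take a large family of blocks of \<open>(k - 1) c\<close> vertices, any two of which share at most one
  vertex. On every block, each \<open>f\<close> is constant on some set \<open>S\<close> of \<open>k - 1\<close> vertices. Go through
  the blocks one by one, choose in each the pair of a set \<open>S\<close> and a colour \<open>i\<close> that serves the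
  largest number of remaining maps \<open>f\<close>, and give the edges inside \<open>S\<close> the colour \<open>i\<close>; this never
  conflicts, as blocks are edge-disjoint. The number of remaining maps decays exponentially in
  the number of blocks, which is quadratic in the number of vertices when the block size is
  fixed, so finally no map remains.\<close>

section \<open>Reduction to maps from vertices to colours\<close>

text \<open>Pick one new vertex \<open>v\<close> of the extension and let \<open>f\<close> give the
  colours of its edges into \<open>G\<close>; adding \<open>v\<close> to the clique found for
  \<open>f\<close> yields the new clique. The maps are extensional so that only finitely many have
  to be served.\<close>

lemma semisaturatedI:
  assumes "G \<in> coloured_complete_graphs c" and "k \<ge> 1"
    and hit: "\<And>f. f \<in> verts G \<rightarrow>\<^sub>E {1..c} \<Longrightarrow>
      \<exists>i\<in>{1..c}. \<exists>K. mono_clique (k - 1) i G K \<and> (\<forall>u\<in>K. f u = i)"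
  shows "semisaturated k c G"
  unfolding semisaturated_def
proof (intro conjI ballI impI)
  show "G \<in> coloured_complete_graphs c" by fact
next
  fix G' assume G': "G' \<in> coloured_complete_graphs c" and ext: "extends G' G"
  then obtain v where v: "v \<in> verts G'" "v \<notin> verts G" and sub: "verts G \<subseteq> verts G'"
    unfolding extends_def by blast
  have edge: "{u, v} \<in> edges G'" if "u \<in> verts G" for u
    using that v sub by (auto simp: edges_def nsets_def card_insert_if)
  define f where "f = restrict (\<lambda>u. colour G' {u, v}) (verts G)"
  have "f \<in> verts G \<rightarrow>\<^sub>E {1..c}"
    using G' edge unfolding f_def coloured_complete_graphs_def by auto
  then obtain i K where i: "i \<in> {1..c}" and K: "mono_clique (k - 1) i G K" "\<forall>u\<in>K. f u = i"
    using hit by blast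
  have KV: "K \<subseteq> verts G" "finite K" "card K = k - 1"
    using K unfolding mono_clique_def nsets_def by auto
  have col: "colour G' e = i" if e: "e \<in> nsets (insert v K) 2" for e
  proof (cases "v \<in> e")
    case True
    then obtain u where u: "e = {u, v}" "u \<noteq> v"
      using e by (auto simp: nsets_def card_2_iff)
    then have "u \<in> K" using e by (auto simp: nsets_def)
    then have "f u = i" "u \<in> verts G" using K(2) KV(1) by blast+
    then show ?thesis using u(1) by (simp add: f_def)
  next
    case False
    then have "e \<in> nsets K 2" using e by (auto simp: nsets_def)
    moreover from this have "e \<in> edges G" using KV by (auto simp: edges_def nsets_def)
    ultimately show ?thesis using K(1) ext by (auto simp: mono_clique_def extends_def)
  qed
  have "mono_clique k i G' (insert v K)"
    unfolding mono_clique_def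
  proof
    have "card (insert v K) = k" using KV v \<open>k \<ge> 1\<close> by (subst card_insert_disjoint) auto
    then show "insert v K \<in> nsets (verts G') k"
      using KV v sub by (auto simp: nsets_def)
  qed (use col in blast)
  then show "\<exists>i\<in>{1..c}. \<exists>K. mono_clique k i G' K \<and> \<not> K \<subseteq> verts G"
    using i v by blast
qed

lemma osat_le:
  assumes "semisaturated k c G" and "card (verts G) \<le> n"
  shows "osat k c \<le> enat n"
proof -
  have "osat k c \<le> enat (card (verts G))"
    unfolding osat_def using assms(1) by (intro INF_lower) auto
  also have "\<dots> \<le> enat n" using assms(2) by simp
  finally show ?thesis .
qed

section \<open>Greedy choice and pigeonhole\<close>

text \<open>Averaging: every \<open>f\<close> is counted for at least one \<open>y\<close>, so the
  counts over the at most \<open>D\<close> choices sum to at least \<open>card F\<close>, and one of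
  them reaches the fraction \<open>1 / D\<close>.\<close>

lemma popular_choice:
  assumes "finite F" and "finite Y" and "card Y \<le> D"
    and "\<And>f. f \<in> F \<Longrightarrow> \<exists>y\<in>Y. R y f" and "Y \<noteq> {}"
  shows "\<exists>y\<in>Y. card F \<le> D * card {f\<in>F. R y f}"
proof (rule ccontr)
  assume "\<not> ?thesis"
  then have less: "D * card {f\<in>F. R y f} < card F" if "y \<in> Y" for y using that by force
  have "F \<subseteq> (\<Union>y\<in>Y. {f\<in>F. R y f})" using assms(4) by auto
  then have "card F \<le> card (\<Union>y\<in>Y. {f\<in>F. R y f})"
    using assms(1,2) by (intro card_mono) auto
  also have "\<dots> \<le> (\<Sum>y\<in>Y. card {f\<in>F. R y f})" using assms(2) by (rule card_UN_le)
  finally have "D * card F \<le> (\<Sum>y\<in>Y. D * card {f\<in>F. R y f})"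
    by (metis mult_le_mono2 sum_distrib_left)
  also have "\<dots> < (\<Sum>y\<in>Y. card F)" using less assms(2,5) by (intro sum_strict_mono) auto
  also have "\<dots> \<le> D * card F" using assms(3) by simp
  finally show False by simp
qed

text \<open>By \<open>popular_choice\<close>, each new index can be given a choice that serves at
  least the fraction \<open>1 / D\<close> of the maps not yet served, so every index contributes one
  factor \<open>1 - 1 / D\<close>.\<close>

lemma greedy_cover:
  assumes "finite I" and "finite F"
    and "\<And>b. b \<in> I \<Longrightarrow> finite (Y b) \<and> Y b \<noteq> {} \<and> card (Y b) \<le> D"
    and "\<And>b f. b \<in> I \<Longrightarrow> f \<in> F \<Longrightarrow> \<exists>y\<in>Y b. R y f"
  shows "\<exists>ch. (\<forall>b\<in>I. ch b \<in> Y b) \<and>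
    real (card {f\<in>F. \<forall>b\<in>I. \<not> R (ch b) f}) \<le> real (card F) * (1 - 1 / real D) ^ card I"
  using assms(1,3,4)
proof (induction I rule: finite_induct)
  case empty
  then show ?case by simp
next
  case (insert b I)
  define r where "r = 1 - 1 / real D"
  \<comment> \<open>Nonemptiness of \<open>Y b\<close> forces \<open>D\<close> to be positive, so
    \<open>r\<close> is nonnegative and the induction hypothesis may be multiplied by it.\<close>
  have "card (Y b) > 0" using insert.prems(1) by (simp add: card_gt_0_iff)
  then have D: "D > 0" using insert.prems(1)[of b] by simp
  then have r: "r \<ge> 0" by (simp add: r_def)
  have "\<exists>ch. (\<forall>b\<in>I. ch b \<in> Y b) \<and>
    real (card {f\<in>F. \<forall>b\<in>I. \<not> R (ch b) f}) \<le> real (card F) * r ^ card I"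
    unfolding r_def by (rule insert.IH) (use insert.prems in auto)
  then obtain ch where ch: "\<forall>b\<in>I. ch b \<in> Y b"
    "real (card {f\<in>F. \<forall>b\<in>I. \<not> R (ch b) f}) \<le> real (card F) * r ^ card I"
    by blast
  define U where "U = {f\<in>F. \<forall>b\<in>I. \<not> R (ch b) f}"
  have fU: "finite U" using assms(2) by (simp add: U_def)
  have "\<exists>y\<in>Y b. card U \<le> D * card {f\<in>U. R y f}"
    using insert.prems fU by (intro popular_choice) (simp_all add: U_def)
  then obtain y where y: "y \<in> Y b" "card U \<le> D * card {f\<in>U. R y f}" by blast
  have "card U = card {f\<in>U. R y f} + card {f\<in>U. \<not> R y f}"
  proof -
    have "U = {f\<in>U. R y f} \<union> {f\<in>U. \<not> R y f}" by blast
    moreover have "card ({f\<in>U. R y f} \<union> {f\<in>U. \<not> R y f}) = card {f\<in>U. R y f} + card {f\<in>U. \<not> R y f}"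
      using fU by (intro card_Un_disjoint) auto
    ultimately show ?thesis by simp
  qed
  moreover have "real (card U) \<le> real D * real (card {f\<in>U. R y f})"
    using y(2) by (metis of_nat_le_iff of_nat_mult)
  ultimately have step: "real (card {f\<in>U. \<not> R y f}) \<le> real (card U) * r"
    using D by (simp add: r_def field_simps)
  have eq: "{f\<in>F. \<forall>b'\<in>insert b I. \<not> R ((ch(b := y)) b') f} = {f\<in>U. \<not> R y f}"
    using insert.hyps by (auto simp: U_def)
  have "real (card {f\<in>U. \<not> R y f}) \<le> real (card F) * r ^ card I * r"
    using step ch(2) r unfolding U_def[symmetric] by (meson mult_right_mono order_trans)
  then have "real (card {f\<in>F. \<forall>b'\<in>insert b I. \<not> R ((ch(b := y)) b') f})
      \<le> real (card F) * r ^ card (insert b I)"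
    unfolding eq using insert.hyps by (simp add: mult_ac)
  moreover have "\<forall>b'\<in>insert b I. (ch(b := y)) b' \<in> Y b'" using ch(1) y(1) by auto
  ultimately show ?case unfolding r_def by blast
qed

text \<open>Pigeonhole: if all \<open>c\<close> colour classes had fewer than \<open>t\<close>
  elements, \<open>B\<close> would have fewer than \<open>t * c\<close>.\<close>

lemma ex_constant_subset:
  assumes "card B = t * c" and "finite B" and "f \<in> B \<rightarrow> {1..c}" and "c \<ge> 1"
  shows "\<exists>S i. S \<in> nsets B t \<and> i \<in> {1..c} \<and> (\<forall>u\<in>S. f u = i)"
proof -
  have "\<exists>i\<in>{1..c}. t \<le> card {u\<in>B. f u = i}"
  proof (rule ccontr)
    assume "\<not> ?thesis"
    then have less: "card {u\<in>B. f u = i} < t" if "i \<in> {1..c}" for i using that by force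
    have "B = (\<Union>i\<in>{1..c}. {u\<in>B. f u = i})" using assms(3) by (fastforce simp: Pi_iff)
    then have "card B = card (\<Union>i\<in>{1..c}. {u\<in>B. f u = i})" by (rule arg_cong)
    also have "\<dots> \<le> (\<Sum>i\<in>{1..c}. card {u\<in>B. f u = i})" by (rule card_UN_le) simp
    also have "\<dots> < (\<Sum>i\<in>{1..c}. t)" using less \<open>c \<ge> 1\<close> by (intro sum_strict_mono) auto
    finally show False using assms(1) by simp
  qed
  then obtain i where i: "i \<in> {1..c}" "t \<le> card {u\<in>B. f u = i}" by blast
  obtain S where "S \<subseteq> {u\<in>B. f u = i}" "card S = t" "finite S"
    by (rule obtain_subset_with_card_n[OF i(2)])
  then have "S \<in> nsets B t \<and> (\<forall>u\<in>S. f u = i)" by (auto simp: nsets_def)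
  then show ?thesis using i(1) by blast
qed

section \<open>Blocks as lines in a grid\<close>

text \<open>The points of the line \<open>x = a + b j\<close>, where the point \<open>(x, j)\<close> is encoded as the number
  \<open>x q + j\<close>.\<close>

definition line :: "nat \<Rightarrow> nat \<times> nat \<Rightarrow> nat set" where
  "line q p = (\<lambda>j. (fst p + snd p * j) * q + j) ` {..<q}"

lemma point_eq_iff:
  fixes x y :: nat
  assumes "i < q" and "j < q"
  shows "x * q + i = y * q + j \<longleftrightarrow> x = y \<and> i = j"
proof
  assume eq: "x * q + i = y * q + j"
  have "(x * q + i) div q = x" "(y * q + j) div q = y" using assms by simp_all
  then have "x = y" using eq by simp
  then show "x = y \<and> i = j" using eq by simp
qed simp

lemma card_line: "card (line q p) = q"
proof -
  have "inj_on (\<lambda>j. (fst p + snd p * j) * q + j) {..<q}"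
    by (rule inj_onI) (simp add: point_eq_iff)
  then show ?thesis by (simp add: line_def card_image)
qed

lemma finite_line: "finite (line q p)"
  by (simp add: line_def)

text \<open>These intercepts and slopes keep the first coordinate below \<open>2 * q * L\<close>,
  and the second is below \<open>q\<close>. For fixed \<open>q\<close> the number of points is thus
  linear in \<open>L\<close>, while there are \<open>q * L ^ 2\<close> pairs
  \<open>p\<close>.\<close>

lemma line_subset:
  assumes "p \<in> {..<q * L} \<times> {..<L}"
  shows "line q p \<subseteq> {..<2 * q ^ 2 * L}"
proof
  fix u assume "u \<in> line q p"
  then obtain j where j: "j < q" "u = (fst p + snd p * j) * q + j" by (auto simp: line_def)
  have ab: "fst p < q * L" "snd p < L" using assms by auto
  have "snd p * j \<le> L * q" using ab j by (intro mult_le_mono) auto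
  then have "fst p + snd p * j + 1 \<le> 2 * q * L" using ab by (simp add: mult.commute)
  then have "(fst p + snd p * j + 1) * q \<le> 2 * q * L * q" by (rule mult_le_mono1)
  then show "u \<in> {..<2 * q ^ 2 * L}"
    using j by (simp add: algebra_simps power2_eq_square)
qed

text \<open>A line has one point for each second coordinate, so the two points have distinct second
  coordinates \<open>i\<close> and \<open>j\<close>. Subtracting the two equations for the first
  coordinates gives \<open>(b - b') * (i - j) = 0\<close>, over the integers because subtraction on
  naturals truncates.\<close>

lemma line_inject:
  assumes "u \<noteq> v" and "{u, v} \<subseteq> line q p" and "{u, v} \<subseteq> line q p'"
  shows "p = p'"
proof -
  obtain a b a' b' where p: "p = (a, b)" "p' = (a', b')" by fastforce
  have "\<exists>j. w = (a + b * j) * q + j \<and> a + b * j = a' + b' * j" if "w \<in> {u, v}" for w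
  proof -
    have "w \<in> line q p" "w \<in> line q p'" using assms that by auto
    then obtain j j' where "j < q" "j' < q" "w = (a + b * j) * q + j" "w = (a' + b' * j') * q + j'"
      unfolding line_def p by auto
    then show ?thesis using point_eq_iff by metis
  qed
  then obtain i j where i: "u = (a + b * i) * q + i" "a + b * i = a' + b' * i"
    and j: "v = (a + b * j) * q + j" "a + b * j = a' + b' * j" by blast
  have "i \<noteq> j" using assms(1) i j by auto
  have "int a + int b * int i = int a' + int b' * int i"
    "int a + int b * int j = int a' + int b' * int j"
    using i(2) j(2) by (metis of_nat_add of_nat_mult)+
  then have "(int b - int b') * (int i - int j) = 0" by (simp add: algebra_simps)
  then have "b = b'" using \<open>i \<noteq> j\<close> by simp
  then show ?thesis using i(2) p by simp
qed

section \<open>Construction of the semisaturated graph\<close>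

lemma semisaturated_lines:
  fixes t c :: nat
  assumes "t \<ge> 1" and "c \<ge> 1"
  defines "q \<equiv> t * c"
  shows "\<exists>G. semisaturated (Suc t) c G \<and> card (verts G) = 4 * c ^ 2 * q ^ (t + 3)"
proof -
  \<comment> \<open>\<open>D\<close> bounds the number of pairs of a \<open>t\<close>-subset of a
    line and a colour. \<open>L\<close> is chosen so that the number \<open>q * L ^ 2\<close> of
    lines equals \<open>n * c * D\<close>.\<close>
  define D where "D = c * q ^ t"
  define L where "L = 2 * q * c * D"
  define n where "n = 2 * q ^ 2 * L"
  define I where "I = {..<q * L} \<times> {..<L}"
  define F where "F = {..<n} \<rightarrow>\<^sub>E {1..c}"
  define Y where "Y p = nsets (line q p) t \<times> {1..c}" for p
  define R where "R y f \<longleftrightarrow> (\<forall>u\<in>fst y. f u = snd y)" for y :: "nat set \<times> nat" and f :: "nat \<Rightarrow> nat"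
  have pos: "q > 0" "D > 0" "n > 0" using assms(1,2) by (auto simp: q_def D_def L_def n_def)
  have n: "n = 4 * c ^ 2 * q ^ (t + 3)"
    by (simp add: n_def L_def D_def power_add power2_eq_square power3_eq_cube)
  have "finite I" by (simp add: I_def)
  have cardI: "card I = n * c * D"
    by (simp add: I_def n_def L_def power2_eq_square)
  have "finite F" by (simp add: F_def finite_PiE)
  have cardF: "card F = c ^ n" by (simp add: F_def card_PiE)
  have in_V: "line q p \<subseteq> {..<n}" if "p \<in> I" for p
    using that line_subset unfolding I_def n_def by blast
  have Rex: "\<exists>y\<in>Y p. R y f" if "p \<in> I" "f \<in> F" for p f
  proof -
    have "f \<in> line q p \<rightarrow> {1..c}" using in_V[OF that(1)] that(2) by (auto simp: F_def)
    from ex_constant_subset[OF _ finite_line this assms(2), of t]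
    obtain S i where "S \<in> nsets (line q p) t" "i \<in> {1..c}" "\<forall>u\<in>S. f u = i"
      by (auto simp: card_line q_def)
    then have "(S, i) \<in> Y p" "R (S, i) f" by (simp_all add: Y_def R_def)
    then show ?thesis by blast
  qed
  have Y: "finite (Y p) \<and> Y p \<noteq> {} \<and> card (Y p) \<le> D" if "p \<in> I" for p
  proof (intro conjI)
    show "finite (Y p)" by (simp add: Y_def finite_imp_finite_nsets finite_line)
    have "(\<lambda>u\<in>{..<n}. 1) \<in> F" using assms(2) by (auto simp: F_def)
    then show "Y p \<noteq> {}" using Rex[OF that] by blast
    have "card (nsets (line q p) t) = q choose t"
      by (simp add: card_nsets finite_line card_line)
    also have "\<dots> \<le> q ^ t" using assms(2) by (intro binomial_le_pow) (simp add: q_def)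
    finally show "card (Y p) \<le> D" by (simp add: Y_def D_def card_cartesian_product)
  qed
  obtain ch where ch: "\<forall>p\<in>I. ch p \<in> Y p"
    "real (card {f\<in>F. \<forall>p\<in>I. \<not> R (ch p) f}) \<le> real (card F) * (1 - 1 / real D) ^ card I"
    using greedy_cover[of I F Y D R] \<open>finite I\<close> \<open>finite F\<close> Y Rex by blast
  \<comment> \<open>With \<open>n * c * D\<close> lines, the decay is at most
    \<open>exp (- c) ^ n\<close>. This beats the number \<open>c ^ n\<close> of maps because
    \<open>c < exp c\<close>, so the number of unserved maps is below 1 and hence zero.\<close>
  have "0 \<le> 1 - 1 / real D" "1 - 1 / real D \<le> exp (- 1 / real D)"
    using pos exp_ge_add_one_self[of "- 1 / real D"] by auto
  then have "(1 - 1 / real D) ^ card I \<le> exp (- 1 / real D) ^ card I" by (intro power_mono)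
  then have "real (card F) * (1 - 1 / real D) ^ card I \<le> real c ^ n * exp (- 1 / real D) ^ card I"
    unfolding cardF of_nat_power by (rule mult_left_mono) simp
  also have "exp (- 1 / real D) ^ card I = exp (- real c) ^ n"
    unfolding cardI using pos by (simp add: exp_of_nat_mult[symmetric] mult_ac)
  also have "real c ^ n * exp (- real c) ^ n = (real c * exp (- real c)) ^ n"
    by (simp add: power_mult_distrib)
  also have "real c * exp (- real c) < 1"
  proof -
    have "real c < exp (real c)" using exp_ge_add_one_self[of "real c"] by linarith
    then show ?thesis by (simp add: exp_minus field_simps)
  qed
  then have "(real c * exp (- real c)) ^ n < 1"
    using pos by (simp add: power_less_one_iff)
  finally have "card {f\<in>F. \<forall>p\<in>I. \<not> R (ch p) f} = 0" using ch(2) by linarith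
  then have hit: "\<exists>p\<in>I. R (ch p) f" if "f \<in> F" for f
    using that \<open>finite F\<close> by auto
  \<comment> \<open>An edge lies in at most one chosen set, by \<open>line_inject\<close>, so
    \<open>SOME\<close> finds the right line. Edges in no chosen set get the arbitrary colour
    1.\<close>
  define col where
    "col e = (if \<exists>p\<in>I. e \<subseteq> fst (ch p) then snd (ch (SOME p. p \<in> I \<and> e \<subseteq> fst (ch p))) else 1)"
    for e
  have chI: "fst (ch p) \<subseteq> line q p" "fst (ch p) \<in> nsets {..<n} t" "snd (ch p) \<in> {1..c}"
    if "p \<in> I" for p
    using ch(1) that in_V[OF that] by (auto simp: Y_def nsets_def mem_Times_iff)
  have col: "col e = snd (ch p)" if p: "p \<in> I" and e2: "e \<in> nsets (fst (ch p)) 2" for p e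
  proof -
    obtain u v where e: "e = {u, v}" "u \<noteq> v" "e \<subseteq> fst (ch p)"
      using e2 by (auto simp: nsets_def card_2_iff)
    have "p' = p" if p': "p' \<in> I" "e \<subseteq> fst (ch p')" for p'
    proof (rule line_inject[OF e(2)])
      show "{u, v} \<subseteq> line q p'" using chI(1)[OF p'(1)] p'(2) e(1) by blast
      show "{u, v} \<subseteq> line q p" using chI(1)[OF p] e(1,3) by blast
    qed
    then have "(SOME p'. p' \<in> I \<and> e \<subseteq> fst (ch p')) = p"
      using p e(3) by (intro some_equality) blast+
    moreover have "\<exists>p\<in>I. e \<subseteq> fst (ch p)" using p e(3) by blast
    ultimately show ?thesis unfolding col_def by simp
  qed
  have colc: "col e \<in> {1..c}" for e
  proof (cases "\<exists>p\<in>I. e \<subseteq> fst (ch p)")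
    case True
    then have "\<exists>p. p \<in> I \<and> e \<subseteq> fst (ch p)" by blast
    from someI_ex[OF this] have "(SOME p. p \<in> I \<and> e \<subseteq> fst (ch p)) \<in> I" by blast
    from chI(3)[OF this] show ?thesis using True by (simp add: col_def)
  next
    case False
    then show ?thesis using assms(2) by (simp add: col_def)
  qed
  have "semisaturated (Suc t) c ({..<n}, col)"
  proof (rule semisaturatedI)
    show "({..<n}, col) \<in> coloured_complete_graphs c"
      using colc pos by (auto simp: coloured_complete_graphs_def)
  next
    fix f assume "f \<in> verts ({..<n}, col) \<rightarrow>\<^sub>E {1..c}"
    then have "f \<in> F" by (simp add: F_def)
    then obtain p where p: "p \<in> I" "R (ch p) f" using hit by blast
    then have "mono_clique t (snd (ch p)) ({..<n}, col) (fst (ch p))"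
      using chI(2) col by (simp add: mono_clique_def)
    then show "\<exists>i\<in>{1..c}. \<exists>K. mono_clique (Suc t - 1) i ({..<n}, col) K \<and> (\<forall>u\<in>K. f u = i)"
      using p chI(3)[OF p(1)] unfolding R_def diff_Suc_1 by blast
  qed simp
  then show ?thesis unfolding n[symmetric] by (intro exI[of _ "({..<n}, col)"]) simp
qed

section \<open>Size estimate and small cases\<close>

text \<open>The factor \<open>t ^ (t + 1)\<close> is absorbed into a power of \<open>c\<close> by
  \<open>t \<le> 2 ^ (t - 1) \<le> c ^ (t - 1)\<close>, and the remaining \<open>4 * t ^ 2\<close>
  goes into \<open>48 * (Suc t) ^ 2\<close>. For \<open>t = 2\<close> the exponent obtained this way
  would be too large, so that case is computed directly.\<close>

lemma line_graph_size_bound: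
  fixes t c :: nat
  assumes "t \<ge> 2" and "c \<ge> 2"
  shows "4 * c ^ 2 * (t * c) ^ (t + 3) \<le> 48 * (Suc t) ^ 2 * c ^ ((Suc t) ^ 2)"
proof (cases "t = 2")
  case True
  have "c ^ 7 \<le> c ^ 9" using assms by (intro power_increasing) auto
  moreover have "4 * c ^ 2 * (t * c) ^ (t + 3) = 128 * c ^ 7"
    by (simp add: True power_mult_distrib flip: power_add)
  ultimately show ?thesis using True by simp
next
  case False
  then obtain s where s: "t = Suc s" "s \<ge> 2" using assms by (cases t) auto
  have "t \<le> 2 ^ s" unfolding s by (rule Suc_leI) (rule less_exp)
  also have "\<dots> \<le> c ^ s" using assms by (intro power_mono) auto
  finally have "t ^ (t + 1) \<le> (c ^ s) ^ (t + 1)" by (rule power_mono) simp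
  then have "t ^ (t + 1) * c ^ (t + 5) \<le> (c ^ s) ^ (t + 1) * c ^ (t + 5)" by (rule mult_le_mono1)
  also have "\<dots> = c ^ (s * (t + 1) + (t + 5))" by (simp add: power_mult power_add)
  \<comment> \<open>The exponent on the left is \<open>t ^ 2 + t + 4\<close>, which is at most
    \<open>(t + 1) ^ 2\<close> exactly when \<open>t \<ge> 3\<close>.\<close>
  also have "\<dots> \<le> c ^ ((Suc t) ^ 2)"
    using assms s by (intro power_increasing) (auto simp: power2_eq_square)
  finally have *: "t ^ (t + 1) * c ^ (t + 5) \<le> c ^ ((Suc t) ^ 2)" .
  have "4 * c ^ 2 * (t * c) ^ (t + 3) = (4 * t ^ 2) * (t ^ (t + 1) * c ^ (t + 5))"
  proof -
    have "4 * c ^ 2 * (t * c) ^ (t + 3) = 4 * t ^ (t + 3) * c ^ (t + 5)"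
      by (simp add: power_mult_distrib add.commute flip: power_add)
    moreover have "t ^ (t + 3) = t ^ 2 * t ^ (t + 1)"
      by (simp add: power_add power2_eq_square power3_eq_cube)
    ultimately show ?thesis by simp
  qed
  also have "\<dots> \<le> (48 * (Suc t) ^ 2) * c ^ ((Suc t) ^ 2)"
    by (intro mult_le_mono *) (auto intro: power_mono)
  finally show ?thesis .
qed

theorem theorem2:
  fixes k c :: nat
  assumes "k \<ge> 1" and "c \<ge> 1"
  shows "osat k c \<le> enat (48 * k ^ 2 * c ^ (k ^ 2))"
proof -
  \<comment> \<open>The line construction exceeds the bound when \<open>k = 2\<close> and
    \<open>c\<close> is large, and when \<open>c = 1\<close> and \<open>k\<close> is large; these
    cases get explicit small graphs.\<close>
  consider "k \<le> 2" | "c = 1" | "k \<ge> 3" "c \<ge> 2" using assms by linarith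
  then show ?thesis
  proof cases
    case 1
    have "semisaturated k c ({0}, \<lambda>_. 1)"
    proof (rule semisaturatedI)
      fix f :: "nat \<Rightarrow> nat" assume f: "f \<in> verts ({0}, \<lambda>_. 1::nat) \<rightarrow>\<^sub>E {1..c}"
      \<comment> \<open>The clique is empty for \<open>k = 1\<close> and \<open>{0}\<close> for
        \<open>k = 2\<close>. It has no edges, so it counts as monochromatic in the colour
        \<open>f 0\<close>.\<close>
      have "nsets {..<k - 1} 2 = {}" using 1 by (subst nsets_eq_empty_iff) auto
      moreover have "{..<k - 1} \<in> nsets {0} (k - 1)" using 1 by (auto simp: nsets_def)
      ultimately have "mono_clique (k - 1) (f 0) ({0}, \<lambda>_. 1) {..<k - 1}"
        by (simp add: mono_clique_def)
      moreover have "f u = f 0" if "u \<in> {..<k - 1}" for u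
      proof -
        have "u = 0" using that 1 by simp
        then show ?thesis by simp
      qed
      ultimately show "\<exists>i\<in>{1..c}. \<exists>K. mono_clique (k - 1) i ({0}, \<lambda>_. 1) K \<and> (\<forall>u\<in>K. f u = i)"
        using f by auto
    qed (use assms in \<open>auto simp: coloured_complete_graphs_def\<close>)
    then show ?thesis by (rule osat_le) (use assms in \<open>simp add: Suc_le_eq\<close>)
  next
    case 2
    \<comment> \<open>Taking \<open>k\<close> rather than \<open>k - 1\<close> vertices keeps the
      graph nonempty when \<open>k = 1\<close>.\<close>
    have "semisaturated k c ({..<k}, \<lambda>_. 1)"
    proof (rule semisaturatedI)
      fix f :: "nat \<Rightarrow> nat" assume f: "f \<in> verts ({..<k}, \<lambda>_. 1::nat) \<rightarrow>\<^sub>E {1..c}"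
      have "mono_clique (k - 1) 1 ({..<k}, \<lambda>_. 1) {..<k - 1}"
        by (auto simp: mono_clique_def nsets_def)
      moreover have "\<forall>u\<in>{..<k - 1}. f u = 1" using f 2 by fastforce
      ultimately show "\<exists>i\<in>{1..c}. \<exists>K. mono_clique (k - 1) i ({..<k}, \<lambda>_. 1) K \<and> (\<forall>u\<in>K. f u = i)"
        using 2 by auto
    qed (use assms in \<open>auto simp: coloured_complete_graphs_def lessThan_empty_iff\<close>)
    then show ?thesis by (rule osat_le) (use 2 in \<open>simp add: power2_eq_square\<close>)
  next
    case 3
    then obtain t where t: "k = Suc t" "t \<ge> 2" by (cases k) auto
    then obtain G where "semisaturated k c G" "card (verts G) = 4 * c ^ 2 * (t * c) ^ (t + 3)"
      using semisaturated_lines[of t c] assms by auto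
    then show ?thesis using line_graph_size_bound[OF t(2) 3(2)] t(1) by (intro osat_le) auto
  qed
qed

end
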